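(* Let $n\ge1$. For each $\epsilon>0$ there exists a Meyer set $X=X(\epsilon)$ in $\mathbb{R}^n$, with covering radius denoted $R$, which is non-crystalline (not an ideal crystal), is linearly repetitive, and has the following properties. (i) There is a $T^*>0$ with $$N_X(T^* ) < \Bigl(\frac12+\epsilon\Bigr)\frac{T^*}{R}\quad\text{and}\quad M_X(T^* ) < \Bigl(\frac12+\epsilon\Bigr)T^*.$$ (ii) There is a $T_0>0$ such that, for all $T>T_0$, $$N_X(T) < (1+\epsilon)\frac{T}{R}\quad\text{and}\quad M_X(T) < (\tau+1+\epsilon)\,T,$$ where $\tau=\frac12(1+\sqrt5)$.
   Context: A Delone set in $\mathbb{R}^n$ is a discrete set $X \subset \mathbb{R}^n$ that is uniformly discrete (its packing radius $r$ by equal balls, i.e. half the infimum of the distances between distinct points of $X$, is positive) and relatively dense (its covering radius $R$, i.e. the smallest radius such that the closed balls of that radius centered at points of $X$ cover $\mathbb{R}^n$, is finite). A Meyer set is a Delone set $X$ whose set of differences $X-X$ is also a Delone set. An ideal crystal is a Delone set of the form $X=\Lambda+F$ with $\Lambda$ a full rank lattice in $\mathbb{R}^n$ and $F$ a finite set. For $\mathbf{x}\in X$ and $T>0$, the $T$-patch of $X$ centered at $\mathbf{x}$ is $\mathcal{P}_X(\mathbf{x};T) = X\cap B(\mathbf{x};T)$, where $B(\mathbf{x};T)$ is the open ball with center $\mathbf{x}$ and radius $T$. Two patches are translation-equivalent, $\mathcal{P}_X(\mathbf{x};T)\sim\mathcal{P}_X(\mathbf{y};T)$, if $\mathcal{P}_X(\mathbf{y};T)=\mathcal{P}_X(\mathbf{x};T)+\mathbf{y}-\mathbf{x}$.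 The patch-counting function $N_X(T)$ is the number (possibly infinite) of translation-inequivalent $T$-patches centered at points of $X$. The repetitivity function $M_X(T)$ is the least $M$ (possibly infinite) such that, for every $\mathbf{x}\in X$, every closed ball of radius $M$ in $\mathbb{R}^n$ contains a point $\mathbf{y}\in X$ with $\mathcal{P}_X(\mathbf{y};T)\sim\mathcal{P}_X(\mathbf{x};T)$. $X$ is linearly repetitive if there are constants $c$ and $T_1>0$ such that $M_X(T)<cT$ for all $T\geq T_1$. *)

theory Defs
  imports "HOL-Analysis.Analysis"
begin

(* The radii and the repetitivity function are extended reals: an infimum over the empty
   set is \<infinity>, so they are infinite when no radius works. The two "least radius"
   infima below are attained whenever X is a Delone set. *)

definition packing_radius :: "'a::euclidean_space set \<Rightarrow> ereal" where
  "packing_radius X = Inf {ereal (dist x y) | x y. x \<in> X \<and> y \<in> X \<and> x \<noteq> y} / 2"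

definition covering_radius :: "'a::euclidean_space set \<Rightarrow> ereal" where
  "covering_radius X = Inf {ereal \<rho> | \<rho>. (\<Union>x\<in>X. cball x \<rho>) = UNIV}"

definition delone_set :: "'a::euclidean_space set \<Rightarrow> bool" where
  "delone_set X \<longleftrightarrow> discrete X \<and> 0 < packing_radius X \<and> covering_radius X < \<infinity>"

definition meyer_set :: "'a::euclidean_space set \<Rightarrow> bool" where
  "meyer_set X \<longleftrightarrow> delone_set X \<and> delone_set {x - y | x y. x \<in> X \<and> y \<in> X}"

definition full_rank_lattice :: "'a::euclidean_space set \<Rightarrow> bool" where
  "full_rank_lattice L \<longleftrightarrow>
     (\<exists>B. independent B \<and> span B = UNIV \<and>
          L = {\<Sum>b\<in>B. of_int (k b) *\<^sub>R b | k :: 'a \<Rightarrow> int. True})"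

definition ideal_crystal :: "'a::euclidean_space set \<Rightarrow> bool" where
  "ideal_crystal X \<longleftrightarrow> delone_set X \<and>
     (\<exists>L F. full_rank_lattice L \<and> finite F \<and> X = {a + f | a f. a \<in> L \<and> f \<in> F})"

definition patch :: "'a::euclidean_space set \<Rightarrow> 'a \<Rightarrow> real \<Rightarrow> 'a set" where
  "patch X x T = X \<inter> ball x T"

(* Equivalence of the T-patches centered at x and y. It is a relation between centers, since a
   patch as a bare set does not determine its center. *)
definition patch_equiv :: "'a::euclidean_space set \<Rightarrow> real \<Rightarrow> 'a \<Rightarrow> 'a \<Rightarrow> bool" where
  "patch_equiv X T x y \<longleftrightarrow> patch X y T = (\<lambda>z. z + (y - x)) ` patch X x T"

definition patch_classes :: "'a::euclidean_space set \<Rightarrow> real \<Rightarrow> 'a set set" where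
  "patch_classes X T = X // {(x, y). x \<in> X \<and> y \<in> X \<and> patch_equiv X T x y}"

definition patch_count :: "'a::euclidean_space set \<Rightarrow> real \<Rightarrow> enat" where
  "patch_count X T =
     (if finite (patch_classes X T) then enat (card (patch_classes X T)) else \<infinity>)"

definition repetitivity :: "'a::euclidean_space set \<Rightarrow> real \<Rightarrow> ereal" where
  "repetitivity X T =
     Inf {ereal M | M. \<forall>x\<in>X. \<forall>c. \<exists>y\<in>X. y \<in> cball c M \<and> patch_equiv X T x y}"

definition linearly_repetitive :: "'a::euclidean_space set \<Rightarrow> bool" where
  "linearly_repetitive X \<longleftrightarrow>
     (\<exists>c T\<^sub>1. T\<^sub>1 > 0 \<and> (\<forall>T\<ge>T\<^sub>1. repetitivity X T < ereal (c * T)))"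

end

theory Submission
  imports Defs "HOL-Number_Theory.Fib"
begin

text \<open>
  Everything happens in one coordinate. Put \<open>\<alpha> = 1/\<tau>\<close> and take on the real line the sites
  \<open>k + \<eta> \<lfloor>k \<alpha>\<rfloor>\<close> for integers \<open>k\<close>: a Fibonacci chain whose two tile lengths \<open>1\<close> and \<open>1 + \<eta>\<close>
  are almost equal. In the remaining coordinates use a cubic lattice of tiny mesh \<open>\<delta>\<close>. In the
  resulting set in \<open>n\<close>-space the site of a point determines its patch up to translation, and the
  covering radius and the repetitivity function exceed those of the chain by at most \<open>n \<delta>\<close>; both
  \<open>\<eta>\<close> and \<open>\<delta>\<close> are absorbed in \<open>\<epsilon>\<close>. In particular \<open>R\<close> is close to \<open>1/2\<close>.

  For \<open>T = 1\<close> a patch of the chain is a single point, so there is one patch, while \<open>T/R\<close> is close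
  to \<open>2\<close>, and a ball of radius about \<open>1/2\<close> contains a point. This is the exceptional radius \<open>T'\<close>.

  For large \<open>T\<close> the patch at site \<open>k\<close> is determined by the differences of \<open>\<lfloor>k \<alpha>\<rfloor>\<close> at indices less
  than \<open>T\<close> away, hence by the position of the fractional part of \<open>k \<alpha>\<close> among the points \<open>-j \<alpha>\<close>
  of the circle, \<open>\<bar>j\<bar> < T\<close>. These points cut the circle into at most \<open>2 T + 1\<close> arcs, which bounds
  the number of patches (\<open>heights_agree_classifier\<close>). For repetitivity let \<open>fib m \<le> 2 T < fib (m+1)\<close>
  (up to rounding). Each arc has length at least \<open>\<alpha>^m\<close>, because Fibonacci numbers give the best
  approximations to \<open>\<alpha>\<close> (\<open>inv_golden_best_approximation\<close>), and an arc of that length is visited by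
  the rotation within any \<open>fib (m+2)\<close> consecutive steps (\<open>inv_golden_rotation_hits\<close>). So every
  interval of radius about \<open>fib (m+2) / 2\<close> contains a copy of every patch, and \<open>fib (m+2) / 2\<close> is at
  most about \<open>\<tau>\<^sup>2 T = (\<tau> + 1) T\<close>.

  The differences of sites have the form \<open>m + \<eta> (\<lfloor>m \<alpha>\<rfloor> + d)\<close> with \<open>d\<close> either 0 or 1, which gives the
  Meyer property. For irrational \<open>\<eta>\<close> a translation of the chain into itself would be a
  translation of the sequence \<open>\<lfloor>k \<alpha>\<rfloor>\<close>, which would force \<open>\<alpha>\<close> to be rational; hence there are no
  periods across the layers, and the set is not an ideal crystal.
\<close>

section \<open>Diophantine properties of the inverse golden ratio\<close>

definition inv_golden :: real (\<open>\<alpha>\<close>) where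
  "\<alpha> = (sqrt 5 - 1) / 2"

lemma inv_golden_bounds: "0 < \<alpha>" "\<alpha> < 1"
proof -
  have "sqrt 1 < sqrt 5" "sqrt 5 < sqrt 9"
    by (intro real_sqrt_less_mono; simp)+
  then show "0 < \<alpha>" "\<alpha> < 1"
    by (auto simp: inv_golden_def)
qed

lemma inv_golden_square: "\<alpha>\<^sup>2 = 1 - \<alpha>"
  by (simp add: inv_golden_def power2_eq_square field_simps)

lemma inv_golden_power_Suc_Suc: "\<alpha> ^ Suc (Suc m) = \<alpha> ^ m - \<alpha> ^ Suc m"
proof -
  have "\<alpha> ^ Suc (Suc m) = \<alpha> ^ m * \<alpha>\<^sup>2"
    by (simp add: power2_eq_square)
  then show ?thesis
    by (simp add: inv_golden_square algebra_simps)
qed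

text \<open>
  The number \<open>-\<alpha>\<close> is the algebraic conjugate of \<open>\<tau>\<close>. The formula shows that consecutive
  Fibonacci numbers approximate from opposite sides, the \<open>m\<close>-th one with error \<open>\<alpha>^m\<close>.
\<close>
lemma fib_times_inv_golden:
  "real (fib m) * \<alpha> - of_int (int (fib (Suc m)) - int (fib m)) = - ((- \<alpha>) ^ m)"
proof (induction m rule: fib.induct)
  case (3 m)
  have "(- \<alpha>) ^ Suc (Suc m) = (- \<alpha>) ^ m * \<alpha>\<^sup>2"
    by (simp add: power2_eq_square)
  then have "(- \<alpha>) ^ Suc (Suc m) = (- \<alpha>) ^ m + (- \<alpha>) ^ Suc m"
    by (simp add: inv_golden_square algebra_simps)
  with 3 show ?case
    by (simp add: algebra_simps)
qed auto

text \<open>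
  Two consecutive pairs of Fibonacci neighbours form a basis of the integer plane.
\<close>
lemma fib_coordinates:
  fixes d c :: int
  shows "\<exists>u v. d = u * int (fib m) + v * int (fib (Suc m)) \<and>
               c = u * int (fib (Suc m)) + v * int (fib (Suc (Suc m)))"
proof (induction m)
  case 0
  show ?case by (rule exI[of _ "c - d"], rule exI[of _ d]) simp
next
  case (Suc m)
  then obtain u v where "d = u * int (fib m) + v * int (fib (Suc m))"
    "c = u * int (fib (Suc m)) + v * int (fib (Suc (Suc m)))" by blast
  then show ?case
    by (intro exI[of _ "v - u"] exI[of _ u]) (simp add: algebra_simps)
qed

text \<open>
  In the Fibonacci basis \<open>(u, v)\<close> of \<open>(d, c + d)\<close> the error is \<open>\<alpha>^m \<bar>u - v \<alpha>\<bar>\<close>. If \<open>u\<close> and \<open>v\<close>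
  have opposite signs, or if \<open>v = 0\<close>, this is at least \<open>\<alpha>^m\<close>; otherwise \<open>\<bar>d\<bar>\<close> is
  already as large as \<open>fib (m+1)\<close>.
\<close>
lemma inv_golden_best_approximation:
  fixes d c :: int
  assumes "d \<noteq> 0" "\<bar>d\<bar> < int (fib (Suc m))"
  shows "\<alpha> ^ m \<le> \<bar>of_int d * \<alpha> - of_int c\<bar>"
proof -
  obtain u v where d: "d = u * int (fib m) + v * int (fib (Suc m))"
    and c: "c + d = u * int (fib (Suc m)) + v * int (fib (Suc (Suc m)))"
    using fib_coordinates by blast
  have "of_int d * \<alpha> - of_int c = - ((- \<alpha>) ^ m * (of_int u - of_int v * \<alpha>))"
  proof -
    let ?e = "\<lambda>m. real_of_int (int (fib (Suc m)) - int (fib m))"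
    have "of_int c = of_int u * ?e m + of_int v * ?e (Suc m)"
      using arg_cong[OF c, of real_of_int] arg_cong[OF d, of real_of_int]
      by (simp add: algebra_simps)
    then have "of_int d * \<alpha> - of_int c = of_int u * (real (fib m) * \<alpha> - ?e m)
        + of_int v * (real (fib (Suc m)) * \<alpha> - ?e (Suc m))"
      unfolding d by (simp add: algebra_simps)
    then show ?thesis
      unfolding fib_times_inv_golden by (simp add: algebra_simps)
  qed
  then have eq: "\<bar>of_int d * \<alpha> - of_int c\<bar> = \<alpha> ^ m * \<bar>of_int u - of_int v * \<alpha>\<bar>"
    using inv_golden_bounds by (simp add: abs_mult power_abs)
  have same_sign: False if "0 < v \<and> 0 \<le> u \<or> v < 0 \<and> u \<le> 0"
  proof -
    have "int (fib (Suc m)) \<le> \<bar>v\<bar> * int (fib (Suc m))" 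
      using that by (auto simp: mult_le_cancel_right1)
    also have "\<dots> \<le> \<bar>d\<bar>"
      using that unfolding d
      by (smt (verit) mult_nonneg_nonneg mult_nonpos_nonneg of_nat_0_le_iff mult_minus_left)
    finally show False using assms by simp
  qed
  have "1 \<le> \<bar>of_int u - of_int v * \<alpha>\<bar>"
  proof (cases "v = 0")
    case True
    with d assms(1) have "u \<noteq> 0" by auto
    then have "1 \<le> \<bar>u\<bar>" by simp
    with True show ?thesis by (simp flip: of_int_abs)
  next
    case False
    then consider "v > 0" "u \<le> -1" | "v < 0" "u \<ge> 1"
      using same_sign by force
    then show ?thesis
    proof cases
      case 1
      then have "real_of_int u \<le> -1" "0 \<le> of_int v * \<alpha>"
        using inv_golden_bounds by (auto simp: zero_le_mult_iff)
      then show ?thesis by linarith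
    next
      case 2
      then have "1 \<le> real_of_int u" "of_int v * \<alpha> \<le> 0"
        using inv_golden_bounds by (auto simp: mult_le_0_iff)
      then show ?thesis by linarith
    qed
  qed
  then show ?thesis
    using inv_golden_bounds by (simp add: eq mult_le_cancel_left1)
qed

lemma less_fib: "n < fib (n + 2)"
proof (induction n rule: fib.induct)
  case (3 n)
  then show ?case by (simp add: numeral_2_eq_2)
qed (auto simp: numeral_2_eq_2)

lemma inv_golden_irrational: "\<alpha> \<notin> \<rat>"
proof
  assume "\<alpha> \<in> \<rat>"
  then obtain a b :: int where ab: "b > 0" "\<alpha> = of_int a / of_int b"
    by (elim Rats_cases') auto
  have "\<alpha> ^ (nat b + 1) \<le> \<bar>of_int b * \<alpha> - of_int a\<bar>"
    using ab less_fib[of "nat b"] by (intro inv_golden_best_approximation) auto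
  also have "\<dots> = 0" using ab by (simp add: field_simps)
  finally show False
    using zero_less_power[OF inv_golden_bounds(1), of "nat b + 1"] by linarith
qed

text \<open>
  A half-open arc of length \<open>\<alpha>^m\<close>, starting at \<open>s\<close>, is visited within any \<open>fib (m+2)\<close> consecutive
  steps of the rotation by \<open>\<alpha>\<close>. In the induction step an arc of length \<open>\<alpha>^(m+1)\<close> is extended, by
  length \<open>\<alpha>^(m+2)\<close>, to one of length \<open>\<alpha>^m\<close>. A visit to the added piece is moved into the
  arc by \<open>fib (m+1)\<close> further steps, which shift by \<open>\<alpha>^(m+1)\<close>; the direction of that shift alternates
  with \<open>m\<close> and decides on which side the arc has to be extended.
\<close>
lemma inv_golden_rotation_hits:
  fixes s :: real and l0 :: int
  shows "\<exists>l c. l0 \<le> l \<and> l < l0 + int (fib (Suc (Suc m))) \<and>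
    0 \<le> of_int l * \<alpha> - of_int c - s \<and> of_int l * \<alpha> - of_int c - s < \<alpha> ^ m"
proof (induction m arbitrary: s)
  case 0
  show ?case
    by (rule exI[of _ l0], rule exI[of _ "\<lfloor>of_int l0 * \<alpha> - s\<rfloor>"]) (simp, linarith)
next
  case (Suc m)
  let ?e = "int (fib (Suc (Suc m))) - int (fib (Suc m))"
  \<comment> \<open>left end of the extended arc; for even \<open>m\<close>, \<open>fib (m+1)\<close> steps shift to the right\<close>
  define w where "w = (if even m then s - \<alpha> ^ Suc (Suc m) else s)"
  obtain l c where l: "l0 \<le> l" "l < l0 + int (fib (Suc (Suc m)))"
    and lc: "0 \<le> of_int l * \<alpha> - of_int c - w" "of_int l * \<alpha> - of_int c - w < \<alpha> ^ m"
    using Suc by blast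
  have split: "\<alpha> ^ m = \<alpha> ^ Suc m + \<alpha> ^ Suc (Suc m)"
    using inv_golden_power_Suc_Suc[of m] by simp
  have le: "\<alpha> ^ Suc (Suc m) \<le> \<alpha> ^ Suc m"
    using inv_golden_bounds by (intro power_decreasing) auto
  have step: "of_int (l + int (fib (Suc m))) * \<alpha> - of_int (c + ?e)
      = of_int l * \<alpha> - of_int c + (if even m then \<alpha> ^ Suc m else - (\<alpha> ^ Suc m))"
    using fib_times_inv_golden[of "Suc m"] by (auto simp: algebra_simps)
  define hit where "hit \<longleftrightarrow> 0 \<le> of_int l * \<alpha> - of_int c - s \<and> of_int l * \<alpha> - of_int c - s < \<alpha> ^ Suc m"
  show ?case
  proof (cases hit)
    case True
    then show ?thesis
      using l unfolding hit_def by (intro exI[of _ l] exI[of _ c]) auto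
  next
    case False
    then have "0 \<le> of_int (l + int (fib (Suc m))) * \<alpha> - of_int (c + ?e) - s \<and>
        of_int (l + int (fib (Suc m))) * \<alpha> - of_int (c + ?e) - s < \<alpha> ^ Suc m"
      using lc split le unfolding step hit_def w_def
      by (cases "even m"; simp only: if_True if_False; linarith)
    moreover have "l0 \<le> l + int (fib (Suc m))"
      "l + int (fib (Suc m)) < l0 + int (fib (Suc (Suc (Suc m))))"
      using l by auto
    ultimately show ?thesis by blast
  qed
qed

lemma fib_Suc_Suc_le_golden:
  assumes "\<tau> = 1 / 2 * (1 + sqrt 5)"
  shows "real (fib (Suc (Suc m))) \<le> (\<tau> + 1) * real (fib m) + 1"
proof -
  have \<tau>: "\<tau> = 1 + \<alpha>" using assms by (simp add: inv_golden_def field_simps)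
  have "\<bar>(- \<alpha>) ^ m\<bar> \<le> 1"
    using inv_golden_bounds by (simp add: power_abs power_le_one del: abs_power_minus)
  then have "(- \<alpha>) ^ m \<le> 1"
    by linarith
  then show ?thesis
    using fib_times_inv_golden[of m] by (simp add: \<tau> algebra_simps)
qed

section \<open>Local patterns of the height sequence\<close>

definition height :: "int \<Rightarrow> int" where
  "height k = \<lfloor>of_int k * \<alpha>\<rfloor>"

text \<open>
  The threshold for the fractional part of \<open>k \<alpha>\<close> above which the height gains an extra unit between
  \<open>k\<close> and \<open>k + j\<close>; on the circle it is the point \<open>-j \<alpha>\<close>. For \<open>j = 0\<close> it is 1 and never reached.
\<close>
definition jump :: "int \<Rightarrow> real" where
  "jump j = 1 - frac (of_int j * \<alpha>)"

text \<open>
  The height differences around an index encode the word of tiles there; if they agree, the patches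
  of the two sites are translates of each other.
\<close>
definition heights_agree :: "real \<Rightarrow> int \<Rightarrow> int \<Rightarrow> bool" where
  "heights_agree T k l \<longleftrightarrow>
     (\<forall>j. \<bar>of_int j\<bar> < T \<longrightarrow> height (k + j) - height k = height (l + j) - height l)"

lemma height_0 [simp]: "height 0 = 0"
  by (simp add: height_def)

lemma height_add:
  "height (k + j) = height k + height j + (if jump j \<le> frac (of_int k * \<alpha>) then 1 else 0)"
  by (simp add: height_def jump_def distrib_right floor_add)

text \<open>
  Below radius 1 there is no neighbouring index, so all indices look alike.
\<close>
lemma heights_agree_1: "heights_agree 1 k l"
  unfolding heights_agree_def
proof (intro allI impI)
  fix j :: int
  assume "\<bar>real_of_int j\<bar> < 1"
  then have "j = 0" by linarith
  then show "height (k + j) - height k = height (l + j) - height l" by simp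
qed

lemma heights_agreeI:
  assumes "\<And>j. \<bar>of_int j\<bar> < T \<Longrightarrow>
             jump j \<le> frac (of_int k * \<alpha>) \<longleftrightarrow> jump j \<le> frac (of_int l * \<alpha>)"
  shows "heights_agree T k l"
  using assms by (auto simp: heights_agree_def height_add)

text \<open>
  The class of \<open>k\<close> is the number of thresholds that its fractional part has passed. The sets of
  passed thresholds are nested, so their cardinality determines them.
\<close>
lemma heights_agree_classifier:
  assumes "0 < T"
  obtains f :: "int \<Rightarrow> nat" where "\<And>k. real (f k) \<le> 2 * T"
    and "\<And>k l. f k = f l \<Longrightarrow> heights_agree T k l"
proof -
  define J where "J = {- \<lfloor>T\<rfloor>..\<lfloor>T\<rfloor>} - {0}"
  define S where "S k = {j \<in> J. jump j \<le> frac (of_int k * \<alpha>)}" for k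
  have "finite J" by (simp add: J_def)
  then have fin: "finite (S k)" for k
    by (simp add: S_def)
  have "real (card (S k)) \<le> 2 * T" for k
  proof -
    have "card (S k) \<le> card J"
      by (rule card_mono) (auto simp: S_def J_def)
    also have "card J = nat (2 * \<lfloor>T\<rfloor>)"
      using assms by (simp add: J_def card_Diff_singleton)
    finally show ?thesis using assms
      by linarith
  qed
  moreover have "heights_agree T k l" if "card (S k) = card (S l)" for k l
  proof -
    have eq: "S k = S l" if "frac (of_int k * \<alpha>) \<le> frac (of_int l * \<alpha>)" "card (S k) = card (S l)"
      for k l
      using that by (intro card_subset_eq fin) (auto simp: S_def)
    have "S k = S l"
      using eq[of k l] eq[of l k] that linear by metis
    show ?thesis
    proof (rule heights_agreeI)
      fix j :: int
      assume j: "\<bar>real_of_int j\<bar> < T"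
      show "jump j \<le> frac (of_int k * \<alpha>) \<longleftrightarrow> jump j \<le> frac (of_int l * \<alpha>)"
      proof (cases "j = 0")
        case True
        then show ?thesis
          using frac_lt_1[of "of_int k * \<alpha>"] frac_lt_1[of "of_int l * \<alpha>"] by (simp add: jump_def)
      next
        case False
        with j have "j \<in> J"
          unfolding J_def by (simp add: le_floor_iff) linarith
        with \<open>S k = S l\<close> show ?thesis
          unfolding S_def by blast
      qed
    qed
  qed
  ultimately show ?thesis
    using that[of "\<lambda>k. card (S k)"] by blast
qed

text \<open>
  The thresholds that bound the arc around the fractional part of \<open>k \<alpha>\<close> differ by a multiple of
  \<open>\<alpha>\<close> modulo 1, with a factor of absolute value at most \<open>2 \<lfloor>T\<rfloor>\<close>. Best approximation makes the arc
  long enough to be visited soon; if the factor is 0, the arc is the whole circle.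
\<close>
lemma heights_agree_recurrent:
  assumes m: "2 * \<lfloor>T\<rfloor> < int (fib (Suc m))" and T: "0 < T"
  shows "\<exists>l. l0 \<le> l \<and> l < l0 + int (fib (Suc (Suc m))) \<and> heights_agree T k l"
proof -
  define x where "x = frac (of_int k * \<alpha>)"
  have x: "0 \<le> x" "x < 1" by (simp_all add: x_def frac_lt_1)
  define J where "J = {- \<lfloor>T\<rfloor>..\<lfloor>T\<rfloor>}"
  \<comment> \<open>0 and 1, the latter being the threshold of index 0, close off the first and the last arc\<close>
  define A where "A = insert 0 (jump ` J)"
  have "0 \<in> J" using T by (simp add: J_def)
  have "finite A" by (simp add: A_def J_def)
  have "0 \<in> A" by (simp add: A_def)
  have "1 \<in> A" using \<open>0 \<in> J\<close> unfolding A_def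
    by (intro insertI2 image_eqI[of _ _ 0]) (simp_all add: jump_def)
  define c where "c = Max {a \<in> A. a \<le> x}"
  define c' where "c' = Min {a \<in> A. x < a}"
  have "c \<in> {a \<in> A. a \<le> x}" unfolding c_def
    using \<open>finite A\<close> \<open>0 \<in> A\<close> x by (intro Max_in) auto
  then have c: "c \<in> A" "c \<le> x" by auto
  have c_ge: "a \<le> c" if "a \<in> A" "a \<le> x" for a
    unfolding c_def using that \<open>finite A\<close> by (intro Max_ge) auto
  have "c' \<in> {a \<in> A. x < a}" unfolding c'_def
    using \<open>finite A\<close> \<open>1 \<in> A\<close> x by (intro Min_in) auto
  then have c': "c' \<in> A" "x < c'" by auto
  have c'_le: "c' \<le> a" if "a \<in> A" "x < a" for a
    unfolding c'_def using that \<open>finite A\<close> by (intro Min_le) auto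
  have c0: "0 \<le> c" "c' \<le> 1"
    using c_ge[OF \<open>0 \<in> A\<close>] c'_le[OF \<open>1 \<in> A\<close>] x by auto
  have form: "\<exists>j\<in>J. \<exists>z::int. a = of_int z - of_int j * \<alpha>" if "a \<in> A" for a
  proof (cases "a = 0")
    case True
    with \<open>0 \<in> J\<close> show ?thesis by (intro bexI[of _ 0] exI[of _ 0]) auto
  next
    case False
    with that obtain j where "j \<in> J" "a = jump j" by (auto simp: A_def)
    then show ?thesis
      by (intro bexI[of _ j] exI[of _ "1 + \<lfloor>of_int j * \<alpha>\<rfloor>"]) (auto simp: jump_def frac_def)
  qed
  have gap: "\<alpha> ^ m \<le> c' - c"
  proof -
    obtain i z where i: "i \<in> J" "c = of_int z - of_int i * \<alpha>" using form c by blast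
    obtain j w where j: "j \<in> J" "c' = of_int w - of_int j * \<alpha>" using form c' by blast
    have diff: "c' - c = of_int (i - j) * \<alpha> - of_int (z - w)"
      using i j by (simp add: algebra_simps)
    have pos: "c' - c > 0" using c c' by simp
    show ?thesis
    proof (cases "i = j")
      case True
      with diff pos have "c' - c = of_int (w - z)" "w - z > 0" by auto
      then have "1 \<le> c' - c" by linarith
      moreover have "\<alpha> ^ m \<le> 1" using inv_golden_bounds by (simp add: power_le_one)
      ultimately show ?thesis by linarith
    next
      case False
      have "\<bar>i - j\<bar> < int (fib (Suc m))"
        using i j m by (auto simp: J_def)
      with False have "\<alpha> ^ m \<le> \<bar>c' - c\<bar>"
        unfolding diff by (intro inv_golden_best_approximation) auto
      with pos show ?thesis by simp
    qed
  qed
  obtain l z where l: "l0 \<le> l" "l < l0 + int (fib (Suc (Suc m)))"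
    and lz: "0 \<le> of_int l * \<alpha> - of_int z - c" "of_int l * \<alpha> - of_int z - c < \<alpha> ^ m"
    using inv_golden_rotation_hits by blast
  have "\<lfloor>of_int l * \<alpha>\<rfloor> = z"
    using lz c0 gap by (intro floor_unique) linarith+
  then have y: "c \<le> frac (of_int l * \<alpha>)" "frac (of_int l * \<alpha>) < c'"
    using lz gap by (simp_all add: frac_def)
  have "heights_agree T k l"
  proof (rule heights_agreeI)
    fix j :: int
    assume j: "\<bar>real_of_int j\<bar> < T"
    then have "j \<in> J"
      unfolding J_def by (simp add: le_floor_iff) linarith
    then have "jump j \<in> A" by (simp add: A_def)
    then show "jump j \<le> frac (of_int k * \<alpha>) \<longleftrightarrow> jump j \<le> frac (of_int l * \<alpha>)"
      using c_ge c'_le y unfolding x_def[symmetric] by (meson leD leI less_le_trans order.trans)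
  qed
  with l show ?thesis by blast
qed

section \<open>The Fibonacci chain\<close>

definition site :: "real \<Rightarrow> int \<Rightarrow> real" where
  "site \<eta> k = of_int k + \<eta> * of_int (height k)"

lemma site_0 [simp]: "site \<eta> 0 = 0"
  by (simp add: site_def)

lemma height_mono: "k \<le> l \<Longrightarrow> height k \<le> height l"
  unfolding height_def using inv_golden_bounds by (intro floor_mono mult_right_mono) auto

lemma site_diff_ge:
  assumes "0 \<le> \<eta>" "k \<le> l"
  shows "of_int (l - k) \<le> site \<eta> l - site \<eta> k"
proof -
  have "\<eta> * of_int (height k) \<le> \<eta> * of_int (height l)"
    using assms height_mono by (intro mult_left_mono) auto
  then show ?thesis by (simp add: site_def)
qed

lemma abs_site_diff_ge:
  assumes "0 \<le> \<eta>"
  shows "\<bar>of_int (l - k)\<bar> \<le> \<bar>site \<eta> l - site \<eta> k\<bar>"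
  using site_diff_ge[OF assms, of k l] site_diff_ge[OF assms, of l k]
  by (cases "k \<le> l") auto

lemma site_step:
  assumes "0 \<le> \<eta>"
  shows "site \<eta> (k + 1) \<le> site \<eta> k + (1 + \<eta>)"
proof -
  have "height 1 = 0" using inv_golden_bounds by (simp add: height_def floor_eq_iff)
  then have "height (k + 1) \<le> height k + 1" by (simp add: height_add)
  then have "of_int (height (k + 1)) \<le> real_of_int (height k) + 1" by linarith
  then have "\<eta> * of_int (height (k + 1)) \<le> \<eta> * (real_of_int (height k) + 1)"
    using assms by (rule mult_left_mono)
  then show ?thesis by (simp add: site_def algebra_simps)
qed

lemma site_add_nat_le:
  assumes "0 \<le> \<eta>"
  shows "site \<eta> (k + int n) \<le> site \<eta> k + real n * (1 + \<eta>)"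
proof (induction n)
  case (Suc n)
  then show ?case
    using site_step[OF assms, of "k + int n"] by (simp add: algebra_simps)
qed simp

lemma heights_agree_sym: "heights_agree T k l \<Longrightarrow> heights_agree T l k"
  by (simp add: heights_agree_def)

text \<open>
  Sites with agreeing heights have the same neighbours up to distance \<open>T\<close>, since sites less than
  \<open>T\<close> apart have indices less than \<open>T\<close> apart.
\<close>
lemma site_translate:
  assumes "0 \<le> \<eta>" "heights_agree T k l" "\<bar>t\<bar> < T"
  shows "site \<eta> k + t \<in> range (site \<eta>) \<longleftrightarrow> site \<eta> l + t \<in> range (site \<eta>)"
proof -
  have "site \<eta> l + t \<in> range (site \<eta>)"
    if agree: "heights_agree T k l" and k': "site \<eta> k + t = site \<eta> k'" for k l k'
  proof -
    have "\<bar>of_int (k' - k)\<bar> < T"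
      using abs_site_diff_ge[OF assms(1), of k' k] k' assms(3) by linarith
    with agree have "height k' - height k = height (l + (k' - k)) - height l"
      unfolding heights_agree_def by (metis add_diff_cancel_left' diff_add_cancel add.commute)
    then have "real_of_int (height (l + (k' - k)))
        = of_int (height k') - of_int (height k) + of_int (height l)" by linarith
    moreover have "site \<eta> l + t = site \<eta> l + site \<eta> k' - site \<eta> k"
      using k' by simp
    ultimately have "site \<eta> l + t = site \<eta> (l + (k' - k))"
      unfolding site_def by (simp only: of_int_add of_int_diff) (simp add: algebra_simps)
    then show ?thesis by simp
  qed
  then show ?thesis
    using assms(2) heights_agree_sym by blast
qed

text \<open>
  An interval of radius \<open>M = (1 + \<eta>) n / 2\<close> contains \<open>n\<close> consecutive sites: the last site to the left of
  the interval is followed by \<open>n\<close> steps of length at most \<open>1 + \<eta>\<close>.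
\<close>
lemma sites_in_interval:
  assumes \<eta>: "0 \<le> \<eta>"
  obtains l0 where "\<And>l. l0 \<le> l \<Longrightarrow> l < l0 + int n \<Longrightarrow> \<bar>site \<eta> l - c\<bar> \<le> (1 + \<eta>) / 2 * real n"
proof -
  define y where "y = c - (1 + \<eta>) / 2 * real n"
  obtain N :: nat where "- y < real N"
    using reals_Archimedean2 by blast
  then have "site \<eta> (- int N) < y"
    using site_diff_ge[OF \<eta>, of "- int N" 0] by simp
  define q where "q = (LEAST q. y \<le> site \<eta> (- int N + int q))"
  obtain p :: nat where "y - site \<eta> (- int N) \<le> real p"
    using real_arch_simple by blast
  then have "y \<le> site \<eta> (- int N + int p)"
    using site_diff_ge[OF \<eta>, of "- int N" "- int N + int p"] by simp
  then have q: "y \<le> site \<eta> (- int N + int q)"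
    unfolding q_def by (rule LeastI)
  with \<open>site \<eta> (- int N) < y\<close> have "q \<noteq> 0" by (intro notI) simp
  then have "site \<eta> (- int N + int (q - 1)) < y"
    using not_less_Least[of "q - 1" "\<lambda>q. y \<le> site \<eta> (- int N + int q)"]
    unfolding q_def[symmetric] by simp
  moreover define l0 where "l0 = - int N + int q"
  moreover have "- int N + int (q - 1) = l0 - 1"
    using \<open>q \<noteq> 0\<close> by (simp add: l0_def)
  ultimately have below: "site \<eta> (l0 - 1) < y"
    by metis
  have "\<bar>site \<eta> l - c\<bar> \<le> (1 + \<eta>) / 2 * real n" if l: "l0 \<le> l" "l < l0 + int n" for l
  proof -
    have "y \<le> site \<eta> l"
      using q site_diff_ge[OF \<eta> l(1)] l(1) unfolding l0_def by linarith
    moreover have "site \<eta> l \<le> y + real n * (1 + \<eta>)"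
    proof -
      define d where "d = nat (l - (l0 - 1))"
      have "site \<eta> l \<le> site \<eta> (l0 - 1) + real d * (1 + \<eta>)"
        using site_add_nat_le[OF \<eta>, of "l0 - 1" d] l by (simp add: d_def)
      also have "real d * (1 + \<eta>) \<le> real n * (1 + \<eta>)"
        using l \<eta> by (intro mult_right_mono) (auto simp: d_def)
      finally show ?thesis using below by linarith
    qed
    ultimately show ?thesis
      unfolding y_def abs_le_iff by (simp add: field_simps)
  qed
  then show ?thesis using that by blast
qed

section \<open>Stacking a chain over a fine lattice\<close>

definition layers :: "'n \<Rightarrow> real \<Rightarrow> real set \<Rightarrow> (real ^ 'n) set" where
  "layers a \<delta> P = {x. x $ a \<in> P \<and> (\<forall>i. i \<noteq> a \<longrightarrow> (\<exists>z::int. x $ i = \<delta> * of_int z))}"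

lemma layers_coordinate:
  "x \<in> layers a \<delta> P \<Longrightarrow> i \<noteq> a \<Longrightarrow> \<exists>z::int. x $ i = \<delta> * of_int z"
  by (auto simp: layers_def)

lemma layers_near:
  fixes c :: "real ^ 'n"
  assumes \<delta>: "0 < \<delta>" and p: "p \<in> P"
  obtains y where "y \<in> layers a \<delta> P" "y $ a = p"
    "dist c y \<le> \<bar>p - c $ a\<bar> + real CARD('n) * \<delta>"
proof -
  define y where "y = (\<chi> i. if i = a then p else \<delta> * of_int \<lfloor>c $ i / \<delta>\<rfloor>)"
  have comp: "\<bar>(y - c) $ i\<bar> \<le> (if i = a then \<bar>p - c $ a\<bar> else 0) + \<delta>" for i
  proof (cases "i = a")
    case False
    have "of_int \<lfloor>c $ i / \<delta>\<rfloor> \<le> c $ i / \<delta>" "c $ i / \<delta> \<le> of_int \<lfloor>c $ i / \<delta>\<rfloor> + 1"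
      by linarith+
    then have "\<delta> * of_int \<lfloor>c $ i / \<delta>\<rfloor> \<le> \<delta> * (c $ i / \<delta>)"
      "\<delta> * (c $ i / \<delta>) \<le> \<delta> * (of_int \<lfloor>c $ i / \<delta>\<rfloor> + 1)"
      using \<delta> by (intro mult_left_mono; simp)+
    then have "\<delta> * of_int \<lfloor>c $ i / \<delta>\<rfloor> \<le> c $ i" "c $ i \<le> \<delta> * of_int \<lfloor>c $ i / \<delta>\<rfloor> + \<delta>"
      using \<delta> by (simp_all add: distrib_left)
    then show ?thesis using False by (simp add: y_def)
  qed (use \<delta> in \<open>simp add: y_def\<close>)
  have "dist c y \<le> (\<Sum>i\<in>UNIV. \<bar>(y - c) $ i\<bar>)"
    unfolding dist_norm norm_minus_commute[of c] by (rule norm_le_l1_cart)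
  also have "\<dots> \<le> (\<Sum>i\<in>UNIV. (if i = a then \<bar>p - c $ a\<bar> else 0) + \<delta>)"
    by (intro sum_mono comp)
  also have "\<dots> = \<bar>p - c $ a\<bar> + real CARD('n) * \<delta>"
    by (simp add: sum.distrib)
  finally show ?thesis
    using p by (intro that[of y]) (auto simp: layers_def y_def)
qed

lemma patch_equiv_sym:
  assumes "patch_equiv X T x y" shows "patch_equiv X T y x"
  using assms by (auto simp: patch_equiv_def image_image)

lemma patch_equiv_trans:
  assumes "patch_equiv X T x y" "patch_equiv X T y z" shows "patch_equiv X T x z"
  using assms by (auto simp: patch_equiv_def image_image algebra_simps)

lemma equiv_patch_equiv: "equiv X {(x, y). x \<in> X \<and> y \<in> X \<and> patch_equiv X T x y}"
  by (rule equivI)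
     (auto simp: refl_on_def patch_equiv_def[of X T x x for x] intro!: symI transI
       intro: patch_equiv_sym patch_equiv_trans)

lemma patch_count_le:
  fixes f :: "'a::euclidean_space \<Rightarrow> nat"
  assumes "\<And>x. x \<in> X \<Longrightarrow> f x < K"
    and "\<And>x y. x \<in> X \<Longrightarrow> y \<in> X \<Longrightarrow> f x = f y \<Longrightarrow> patch_equiv X T x y"
  shows "patch_count X T \<le> enat K"
proof -
  define r where "r = {(x, y). x \<in> X \<and> y \<in> X \<and> patch_equiv X T x y}"
  have r: "equiv X r" unfolding r_def by (rule equiv_patch_equiv)
  define g where "g k = r `` {SOME x. x \<in> X \<and> f x = k}" for k
  have "patch_classes X T \<subseteq> g ` {..<K}"
  proof
    fix C assume "C \<in> patch_classes X T"
    then obtain x where x: "x \<in> X" "C = r `` {x}"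
      by (auto simp: patch_classes_def r_def elim: quotientE)
    have "(SOME y. y \<in> X \<and> f y = f x) \<in> X \<and> f (SOME y. y \<in> X \<and> f y = f x) = f x"
      by (rule someI[of _ x]) (use x in simp)
    then have "(x, SOME y. y \<in> X \<and> f y = f x) \<in> r"
      using x assms(2) unfolding r_def by auto
    then have "C = g (f x)"
      unfolding g_def x(2) using r by (intro equiv_class_eq)
    then show "C \<in> g ` {..<K}" using assms(1) x by blast
  qed
  moreover from this have "finite (patch_classes X T)"
    by (rule finite_subset) simp
  moreover have "card (patch_classes X T) \<le> K"
    using surj_card_le[OF _ \<open>patch_classes X T \<subseteq> g ` {..<K}\<close>] by simp
  ultimately show ?thesis by (simp add: patch_count_def)
qed

text \<open>
  In the lattice directions every difference of points is a period, so only the coordinate \<open>a\<close> matters.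
  There the ball of radius \<open>T\<close> does not reach further than \<open>T\<close>.
\<close>
lemma patch_equiv_layers:
  assumes x: "x \<in> layers a \<delta> P" and y: "y \<in> layers a \<delta> P"
    and local: "\<And>t. \<bar>t\<bar> < T \<Longrightarrow> x $ a + t \<in> P \<longleftrightarrow> y $ a + t \<in> P"
  shows "patch_equiv (layers a \<delta> P) T x y"
proof -
  have shift: "z + (v - u) \<in> patch (layers a \<delta> P) v T"
    if u: "u \<in> layers a \<delta> P" and v: "v \<in> layers a \<delta> P"
      and loc: "\<And>t. \<bar>t\<bar> < T \<Longrightarrow> u $ a + t \<in> P \<longleftrightarrow> v $ a + t \<in> P"
      and z: "z \<in> patch (layers a \<delta> P) u T" for u v z
  proof -
    have zl: "z \<in> layers a \<delta> P" and zd: "dist u z < T"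
      using z by (auto simp: patch_def)
    have "\<bar>(z - u) $ a\<bar> < T"
      using component_le_norm_cart[of "z - u" a] zd
      by (simp add: dist_norm norm_minus_commute)
    from loc[OF this] zl have "(z + (v - u)) $ a \<in> P"
      by (simp add: layers_def algebra_simps)
    moreover have "\<exists>w::int. (z + (v - u)) $ i = \<delta> * of_int w" if ne: "i \<noteq> a" for i
    proof -
      obtain p q s :: int where "z $ i = \<delta> * of_int p" "v $ i = \<delta> * of_int q" "u $ i = \<delta> * of_int s"
        using layers_coordinate[OF zl ne] layers_coordinate[OF u ne]
          layers_coordinate[OF v ne] by blast
      then show ?thesis
        by (intro exI[of _ "p + (q - s)"]) (simp add: algebra_simps)
    qed
    ultimately have "z + (v - u) \<in> layers a \<delta> P" by (simp add: layers_def)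
    moreover have "dist v (z + (v - u)) = dist u z"
      by (simp add: dist_norm algebra_simps)
    ultimately show ?thesis using zd by (simp add: patch_def)
  qed
  show ?thesis
    unfolding patch_equiv_def
  proof (intro subset_antisym subsetI)
    fix z assume "z \<in> patch (layers a \<delta> P) y T"
    then have "z + (x - y) \<in> patch (layers a \<delta> P) x T"
      using shift[of y x z] x y local by blast
    then show "z \<in> (\<lambda>z. z + (y - x)) ` patch (layers a \<delta> P) x T"
      by (rule rev_image_eqI) simp
  next
    fix z assume "z \<in> (\<lambda>z. z + (y - x)) ` patch (layers a \<delta> P) x T"
    then show "z \<in> patch (layers a \<delta> P) y T"
      using shift[of x y] x y local by blast
  qed
qed

section \<open>Patches and covering radius of the stacked chain\<close>

definition golden_layers :: "'n \<Rightarrow> real \<Rightarrow> real \<Rightarrow> (real ^ 'n) set" where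
  "golden_layers a \<eta> \<delta> = layers a \<delta> (range (site \<eta>))"

lemma zero_in_golden_layers: "0 \<in> golden_layers a \<eta> \<delta>"
  by (auto simp: golden_layers_def layers_def intro: range_eqI[of _ _ 0] exI[of _ "0::int"])

lemma patch_equiv_golden_layers:
  assumes "0 \<le> \<eta>" and "x \<in> golden_layers a \<eta> \<delta>" "y \<in> golden_layers a \<eta> \<delta>"
    and "x $ a = site \<eta> k" "y $ a = site \<eta> l" and "heights_agree T k l"
  shows "patch_equiv (golden_layers a \<eta> \<delta>) T x y"
  using assms unfolding golden_layers_def
  by (intro patch_equiv_layers) (auto simp only: site_translate)

lemma patch_count_golden_layers_le:
  fixes f :: "int \<Rightarrow> nat"
  assumes \<eta>: "0 \<le> \<eta>" and f: "\<And>k. f k < K"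
    and agree: "\<And>k l. f k = f l \<Longrightarrow> heights_agree T k l"
  shows "patch_count (golden_layers a \<eta> \<delta>) T \<le> enat K"
proof -
  define ix where "ix x = (SOME k. x $ a = site \<eta> k)" for x :: "real ^ 'a"
  have ix: "x $ a = site \<eta> (ix x)" if "x \<in> golden_layers a \<eta> \<delta>" for x
    unfolding ix_def by (rule someI_ex) (use that in \<open>auto simp: golden_layers_def layers_def\<close>)
  show ?thesis
  proof (rule patch_count_le)
    show "f (ix x) < K" for x by (rule f)
    show "patch_equiv (golden_layers a \<eta> \<delta>) T x y"
      if "x \<in> golden_layers a \<eta> \<delta>" "y \<in> golden_layers a \<eta> \<delta>" "f (ix x) = f (ix y)" for x y
      using patch_equiv_golden_layers[OF \<eta> that(1,2) ix ix agree] that by blast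
  qed
qed

lemma repetitivity_golden_layers_le:
  fixes a :: "'n::finite"
  assumes \<eta>: "0 \<le> \<eta>" and \<delta>: "0 < \<delta>"
    and rec: "\<And>k l0. \<exists>l. l0 \<le> l \<and> l < l0 + int n \<and> heights_agree T k l"
  shows "repetitivity (golden_layers a \<eta> \<delta>) T \<le> ereal ((1 + \<eta>) / 2 * real n + real CARD('n) * \<delta>)"
    (is "_ \<le> ereal ?M")
proof -
  have "\<exists>y\<in>golden_layers a \<eta> \<delta>. y \<in> cball c ?M \<and> patch_equiv (golden_layers a \<eta> \<delta>) T x y"
    if x: "x \<in> golden_layers a \<eta> \<delta>" for x c
  proof -
    obtain k where k: "x $ a = site \<eta> k"
      using x by (auto simp: golden_layers_def layers_def)
    obtain l0 where l0: "\<And>l. l0 \<le> l \<Longrightarrow> l < l0 + int n \<Longrightarrow>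
        \<bar>site \<eta> l - c $ a\<bar> \<le> (1 + \<eta>) / 2 * real n"
      using sites_in_interval[OF \<eta>] by blast
    obtain l where l: "l0 \<le> l" "l < l0 + int n" "heights_agree T k l"
      using rec by blast
    obtain y where y: "y \<in> golden_layers a \<eta> \<delta>" "y $ a = site \<eta> l"
      "dist c y \<le> \<bar>site \<eta> l - c $ a\<bar> + real CARD('n) * \<delta>"
      unfolding golden_layers_def
      by (rule layers_near[OF \<delta> rangeI[of "site \<eta>" l], where a = a and c = c])
    have "dist c y \<le> ?M" using l0[OF l(1,2)] y(3) by linarith
    moreover have "patch_equiv (golden_layers a \<eta> \<delta>) T x y"
      using \<eta> x y(1) k y(2) l(3) by (rule patch_equiv_golden_layers)
    ultimately show ?thesis
      using y(1) by (intro bexI[of _ y] conjI) (simp_all only: mem_cball)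
  qed
  then show ?thesis
    unfolding repetitivity_def by (intro Inf_lower) blast
qed

lemma golden_layers_cover:
  fixes a :: "'n::finite"
  assumes \<eta>: "0 \<le> \<eta>" and \<delta>: "0 < \<delta>"
  shows "(\<Union>x\<in>golden_layers a \<eta> \<delta>. cball x ((1 + \<eta>) / 2 + real CARD('n) * \<delta>)) = UNIV"
proof -
  have "\<exists>y\<in>golden_layers a \<eta> \<delta>. dist y c \<le> (1 + \<eta>) / 2 + real CARD('n) * \<delta>" for c
  proof -
    obtain l where l: "\<bar>site \<eta> l - c $ a\<bar> \<le> (1 + \<eta>) / 2 * real 1"
      using sites_in_interval[OF \<eta>, of 1] by (metis add_strict_increasing zero_less_one int_ops(2) less_add_one order_refl)
    obtain y where "y \<in> golden_layers a \<eta> \<delta>"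
      "dist c y \<le> \<bar>site \<eta> l - c $ a\<bar> + real CARD('n) * \<delta>"
      unfolding golden_layers_def
      by (rule layers_near[OF \<delta> rangeI[of "site \<eta>" l], where a = a and c = c])
    moreover from this l have "dist y c \<le> (1 + \<eta>) / 2 + real CARD('n) * \<delta>"
      unfolding dist_commute[of y] by (simp add: field_simps)
    ultimately show ?thesis by blast
  qed
  then show ?thesis by (auto simp: set_eq_iff)
qed

text \<open>
  The lower bound comes from the point with coordinate \<open>1/2\<close> in direction \<open>a\<close>: no site
  lies strictly between 0 and 1. It guarantees that quotients \<open>T/R\<close> have a positive denominator.
\<close>
lemma covering_radius_golden_layers:
  fixes a :: "'n::finite"
  assumes \<eta>: "0 \<le> \<eta>" and \<delta>: "0 < \<delta>"
  obtains R where "covering_radius (golden_layers a \<eta> \<delta>) = ereal R"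
    "1 / 2 \<le> R" "R \<le> (1 + \<eta>) / 2 + real CARD('n) * \<delta>"
proof -
  let ?X = "golden_layers a \<eta> \<delta>"
  have upper: "covering_radius ?X \<le> ereal ((1 + \<eta>) / 2 + real CARD('n) * \<delta>)"
    unfolding covering_radius_def using golden_layers_cover[OF assms]
    by (intro Inf_lower) blast
  have "1 / 2 \<le> \<rho>" if "(\<Union>x\<in>?X. cball x \<rho>) = UNIV" for \<rho>
  proof -
    have "axis a (1/2) \<in> (\<Union>x\<in>?X. cball x \<rho>)" using that by simp
    then obtain x where x: "x \<in> ?X" "dist x (axis a (1/2)) \<le> \<rho>" by auto
    obtain k where k: "x $ a = site \<eta> k"
      using x by (auto simp: golden_layers_def layers_def)
    have "1 / 2 \<le> \<bar>site \<eta> k - 1 / 2\<bar>"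
    proof (cases "k \<le> 0")
      case True
      then show ?thesis using site_diff_ge[OF \<eta>, of k 0] by simp
    next
      case False
      then show ?thesis using site_diff_ge[OF \<eta>, of 0 k] by simp
    qed
    also have "\<dots> = \<bar>(x - axis a (1/2)) $ a\<bar>" by (simp add: k axis_def)
    also have "\<dots> \<le> norm (x - axis a (1/2))" by (rule component_le_norm_cart)
    also have "\<dots> \<le> \<rho>" using x by (simp add: dist_norm)
    finally show ?thesis .
  qed
  then have "ereal (1 / 2) \<le> covering_radius ?X"
    unfolding covering_radius_def by (intro Inf_greatest) auto
  with upper show ?thesis
    by (cases "covering_radius ?X") (auto intro: that)
qed

section \<open>The Meyer property\<close>

lemma delone_setI:
  assumes "0 < r" "\<And>x y. x \<in> X \<Longrightarrow> y \<in> X \<Longrightarrow> x \<noteq> y \<Longrightarrow> r \<le> dist x y"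
    and "(\<Union>x\<in>X. cball x \<rho>) = UNIV"
  shows "delone_set X"
proof -
  have "uniform_discrete X" by (rule uniformI2) (use assms in auto)
  then have "discrete X" by (rule uniform_discrete_imp_discrete)
  moreover have "ereal r \<le> Inf {ereal (dist x y) | x y. x \<in> X \<and> y \<in> X \<and> x \<noteq> y}"
    using assms(2) by (intro Inf_greatest) auto
  then have "0 < Inf {ereal (dist x y) | x y. x \<in> X \<and> y \<in> X \<and> x \<noteq> y}"
    using assms(1) by (meson ereal_less(2) less_le_trans)
  then have "0 < packing_radius X"
    unfolding packing_radius_def by (subst ereal_less_divide_pos) auto
  moreover have "covering_radius X \<le> ereal \<rho>"
    unfolding covering_radius_def using assms(3) by (intro Inf_lower) blast
  then have "covering_radius X < \<infinity>" by (rule order.strict_trans1) simp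
  ultimately show ?thesis by (simp add: delone_set_def)
qed

lemma site_difference:
  obtains m d :: int where "site \<eta> k - site \<eta> l = of_int m + \<eta> * (of_int (height m) + of_int d)"
    "d \<in> {0, 1}"
proof -
  define d where "d = height (l + (k - l)) - height l - height (k - l)"
  have "d \<in> {0, 1}" unfolding d_def height_add by auto
  moreover have "height k = height l + height (k - l) + d" by (simp add: d_def)
  then have "site \<eta> k - site \<eta> l = of_int (k - l) + \<eta> * (of_int (height (k - l)) + of_int d)"
    by (simp add: site_def algebra_simps)
  ultimately show ?thesis using that by blast
qed

text \<open>
  A difference of sites has the form \<open>m + \<eta> (height m + d)\<close> with \<open>d\<close> equal to 0 or 1. For
  different \<open>m\<close> two such numbers are at least \<open>1 - \<eta>\<close> apart, by monotonicity of the
  height; for equal \<open>m\<close> they differ by \<open>\<eta>\<close>. The bound \<open>\<eta> \<le> 1/2\<close> makes \<open>\<eta>\<close> the smaller of the two.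
\<close>
lemma site_differences_separated:
  assumes \<eta>: "0 < \<eta>" "\<eta> \<le> 1 / 2"
    and ne: "site \<eta> k - site \<eta> l \<noteq> site \<eta> k' - site \<eta> l'"
  shows "\<eta> \<le> \<bar>(site \<eta> k - site \<eta> l) - (site \<eta> k' - site \<eta> l')\<bar>"
proof -
  obtain m d where 1: "site \<eta> k - site \<eta> l = of_int m + \<eta> * (of_int (height m) + of_int d)"
    "d \<in> {0, 1}" by (rule site_difference)
  obtain m' d' where 2: "site \<eta> k' - site \<eta> l' = of_int m' + \<eta> * (of_int (height m') + of_int d')"
    "d' \<in> {0, 1}" by (rule site_difference)
  have sep: "\<eta> \<le> (of_int m' + \<eta> * (of_int (height m') + of_int d'))
      - (of_int m + \<eta> * (of_int (height m) + of_int d))"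
    if "m < m'" "d \<in> {0, 1}" "d' \<in> {0, 1}" for m m' d d' :: int
  proof -
    have "\<eta> * (of_int (height m) + of_int d) \<le> \<eta> * (of_int (height m') + of_int d' + 1)"
      using \<eta> that height_mono[of m m'] by (intro mult_left_mono) auto
    moreover have "1 \<le> real_of_int m' - of_int m" using that by linarith
    ultimately show ?thesis using \<eta> by (simp add: algebra_simps)
  qed
  show ?thesis
  proof (cases m m' rule: linorder_cases)
    case equal
    with ne 1 2 show ?thesis using \<eta> by (auto simp: algebra_simps)
  next
    case less
    show ?thesis using sep[OF less 1(2) 2(2)] unfolding 1(1) 2(1) by linarith
  next
    case greater
    show ?thesis using sep[OF greater 2(2) 1(2)] unfolding 1(1) 2(1) by linarith
  qed
qed

text \<open>
  Since the set contains 0, it lies in its difference set. Hence separation is only needed for the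
  difference set, and relative density only for the set itself.
\<close>
lemma meyer_set_golden_layers:
  fixes a :: "'n::finite"
  assumes \<eta>: "0 < \<eta>" "\<eta> \<le> 1 / 2" and \<delta>: "0 < \<delta>"
  shows "meyer_set (golden_layers a \<eta> \<delta>)"
proof -
  let ?X = "golden_layers a \<eta> \<delta>"
  define D where "D = {x - y | x y. x \<in> ?X \<and> y \<in> ?X}"
  have sub: "?X \<subseteq> D"
    unfolding D_def using zero_in_golden_layers[of a \<eta> \<delta>] by (force intro: exI[of _ 0])
  have sep: "min \<eta> \<delta> \<le> dist x y" if "x \<in> D" "y \<in> D" "x \<noteq> y" for x y
  proof -
    obtain i where i: "x $ i \<noteq> y $ i" using \<open>x \<noteq> y\<close> by (auto simp: vec_eq_iff)
    have "min \<eta> \<delta> \<le> \<bar>x $ i - y $ i\<bar>"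
    proof (cases "i = a")
      case True
      have "\<exists>k l. u $ a = site \<eta> k - site \<eta> l" if "u \<in> D" for u
        using that by (force simp: D_def golden_layers_def layers_def)
      with that True i show ?thesis
        using site_differences_separated[OF \<eta>] by (metis min.coboundedI1)
    next
      case False
      have "\<exists>z::int. u $ i = \<delta> * of_int z" if u: "u \<in> D" for u
      proof -
        obtain v w where "u = v - w" and v: "v \<in> ?X" and w: "w \<in> ?X"
          using u by (auto simp: D_def)
        obtain p q :: int where "v $ i = \<delta> * of_int p" "w $ i = \<delta> * of_int q"
          using layers_coordinate[OF v[unfolded golden_layers_def] False]
            layers_coordinate[OF w[unfolded golden_layers_def] False] by blast
        with \<open>u = v - w\<close> show ?thesis
          by (intro exI[of _ "p - q"]) (simp add: right_diff_distrib)
      qed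
      with that obtain p q :: int where pq: "x $ i = \<delta> * of_int p" "y $ i = \<delta> * of_int q"
        by blast
      with i have "p \<noteq> q" by auto
      then have "1 \<le> \<bar>p - q\<bar>" by simp
      then have "1 \<le> real_of_int \<bar>p - q\<bar>" by linarith
      then have "\<delta> \<le> \<delta> * real_of_int \<bar>p - q\<bar>" using \<delta> by simp
      also have "\<dots> = \<bar>x $ i - y $ i\<bar>"
        using \<delta> unfolding pq by (simp add: abs_mult flip: right_diff_distrib of_int_diff)
      finally show ?thesis by simp
    qed
    also have "\<dots> \<le> dist x y"
      using component_le_norm_cart[of "x - y" i] by (simp add: dist_norm)
    finally show ?thesis .
  qed
  have cover: "(\<Union>x\<in>?X. cball x ((1 + \<eta>) / 2 + real CARD('n) * \<delta>)) = UNIV"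
    using \<eta> \<delta> by (intro golden_layers_cover) auto
  have "delone_set ?X"
    by (rule delone_setI[OF _ _ cover, of "min \<eta> \<delta>"]) (use \<eta> \<delta> sub sep in auto)
  moreover have "(\<Union>x\<in>D. cball x ((1 + \<eta>) / 2 + real CARD('n) * \<delta>)) = UNIV"
    using sub cover by blast
  from delone_setI[OF _ sep this] have "delone_set D"
    using \<eta> \<delta> by simp
  ultimately show ?thesis by (simp add: meyer_set_def D_def)
qed

section \<open>Absence of periods\<close>

text \<open>
  If \<open>v\<close> is the site \<open>q\<close> then, as \<open>\<eta>\<close> is irrational, \<open>n v\<close> can only be the site \<open>n q\<close>, so heights are
  additive along multiples of \<open>q\<close>. But \<open>n\<close> times the error \<open>\<bar>q \<alpha> - \<lfloor>q \<alpha>\<rfloor>\<bar>\<close> then stays below 1 for all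
  \<open>n\<close>, which contradicts the irrationality of \<open>\<alpha>\<close> unless \<open>q = 0\<close>.
\<close>
lemma site_no_period:
  assumes \<eta>: "\<eta> \<notin> \<rat>" and period: "\<And>n::nat. real n * v \<in> range (site \<eta>)"
  shows "v = 0"
proof (rule ccontr)
  assume "v \<noteq> 0"
  obtain q where q: "v = site \<eta> q" using period[of 1] by auto
  with \<open>v \<noteq> 0\<close> have "q \<noteq> 0" by auto
  have mult: "height (int n * q) = int n * height q" for n
  proof -
    obtain r where "real n * v = site \<eta> r" using period by auto
    then have eq: "of_int (int n * q - r) = \<eta> * of_int (height r - int n * height q)"
      by (simp add: q site_def algebra_simps)
    have "height r - int n * height q = 0"
    proof (rule ccontr)
      assume "height r - int n * height q \<noteq> 0"
      then have "of_int (height r - int n * height q) \<noteq> (0::real)"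
        by (simp only: of_int_eq_0_iff not_False_eq_True)
      then have "\<eta> = of_int (int n * q - r) / of_int (height r - int n * height q)"
        unfolding eq by (rule nonzero_mult_div_cancel_right[symmetric])
      with \<eta> show False by (metis Rats_divide Rats_of_int)
    qed
    moreover from this eq have "int n * q - r = 0"
      by (metis mult_zero_right of_int_0 of_int_eq_0_iff)
    ultimately show ?thesis by simp
  qed
  define e where "e = \<bar>of_int q * \<alpha> - of_int (height q)\<bar>"
  have "real n * e < 1" for n
  proof -
    have "real n * e = \<bar>of_int (int n * q) * \<alpha> - of_int (height (int n * q))\<bar>"
      unfolding mult e_def by (simp add: abs_mult mult.assoc flip: right_diff_distrib)
    also have "\<dots> < 1" unfolding height_def by linarith
    finally show ?thesis .
  qed
  then have "e = 0"
    using ex_less_of_nat_mult[of e 1] by (metis abs_ge_zero e_def less_asym order_le_less)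
  then have "\<alpha> = of_int (height q) / of_int q"
    using \<open>q \<noteq> 0\<close> by (simp add: e_def field_simps)
  with inv_golden_irrational show False
    by (metis Rats_divide Rats_of_int)
qed

text \<open>
  A basis of a full rank lattice contains a vector with nonzero coordinate in direction \<open>a\<close>, and
  that vector is a period. As 0 is a point of the set, all multiples of the coordinate are sites.
\<close>
lemma not_ideal_crystal_golden_layers:
  assumes \<eta>: "\<eta> \<notin> \<rat>"
  shows "\<not> ideal_crystal (golden_layers a \<eta> \<delta>)"
proof
  let ?X = "golden_layers a \<eta> \<delta>"
  assume "ideal_crystal ?X"
  then obtain L F where "full_rank_lattice L" and X: "?X = {x + f | x f. x \<in> L \<and> f \<in> F}"
    by (auto simp: ideal_crystal_def)
  then obtain B where B: "independent B" "span B = UNIV"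
    and L: "L = {\<Sum>b\<in>B. of_int (k b) *\<^sub>R b | k :: _ \<Rightarrow> int. True}"
    by (auto simp: full_rank_lattice_def)
  have "finite B" using B by (simp add: independent_imp_finite)
  obtain b where b: "b \<in> B" "b $ a \<noteq> 0"
  proof (rule ccontr)
    assume "\<not> thesis"
    with that have "B \<subseteq> {x. x $ a = 0}" by auto
    then have "span B \<subseteq> {x. x $ a = 0}"
      by (rule span_minimal) (auto simp: subspace_def)
    with B have "axis a (1::real) \<in> {x. x $ a = 0}" by blast
    then show False by (simp add: axis_def)
  qed
  have L_add: "x + b \<in> L" if "x \<in> L" for x
  proof -
    obtain k :: "_ \<Rightarrow> int" where k: "x = (\<Sum>c\<in>B. of_int (k c) *\<^sub>R c)"
      using \<open>x \<in> L\<close> by (auto simp: L)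
    have "(\<Sum>c\<in>B. of_int ((k(b := k b + 1)) c) *\<^sub>R c)
        = (\<Sum>c\<in>B. of_int (k c) *\<^sub>R c + (if c = b then b else 0))"
      by (intro sum.cong) (auto simp: scaleR_left_distrib)
    also have "\<dots> = x + b"
      using \<open>finite B\<close> b by (simp add: sum.distrib k)
    finally show ?thesis unfolding L
      by (intro CollectI exI[of _ "k(b := k b + 1)"]) simp
  qed
  have X_add: "x + b \<in> ?X" if x: "x \<in> ?X" for x
  proof -
    obtain y f where "x = y + f" "y \<in> L" "f \<in> F" using x unfolding X by blast
    then have "x + b = (y + b) + f" "y + b \<in> L" "f \<in> F" using L_add by auto
    then show ?thesis unfolding X by blast
  qed
  have "real n *\<^sub>R b \<in> ?X" for n
  proof (induction n)
    case 0
    show ?case by (simp add: zero_in_golden_layers)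
  next
    case (Suc n)
    from X_add[OF this] show ?case by (simp add: scaleR_left_distrib add.commute)
  qed
  then have "real n * b $ a \<in> range (site \<eta>)" for n
    by (force simp: golden_layers_def layers_def)
  with site_no_period[OF \<eta>] b show False by blast
qed

section \<open>Linear bounds\<close>

lemma fib_bracket:
  fixes N :: nat
  obtains m where "fib m \<le> N" "N < fib (Suc m)"
proof -
  define m where "m = (LEAST m. N < fib (Suc m))"
  have "N < fib (Suc (Suc N))" using less_fib[of N] by simp
  then have "N < fib (Suc m)" unfolding m_def by (rule LeastI)
  moreover have "fib m \<le> N"
  proof (cases m)
    case (Suc m')
    then have "\<not> N < fib (Suc m')"
      unfolding m_def by (intro not_less_Least) simp
    with Suc show ?thesis by simp
  qed simp
  ultimately show ?thesis using that by blast
qed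

lemma patch_count_golden_layers:
  assumes "0 \<le> \<eta>" "0 < T"
  shows "ereal_of_enat (patch_count (golden_layers a \<eta> \<delta>) T) \<le> ereal (2 * T + 1)"
proof -
  obtain f :: "int \<Rightarrow> nat" where f: "\<And>k. real (f k) \<le> 2 * T"
    and agree: "\<And>k l. f k = f l \<Longrightarrow> heights_agree T k l"
    using heights_agree_classifier[OF assms(2)] by blast
  define K where "K = nat \<lfloor>2 * T\<rfloor> + 1"
  have "f k < K" for k
    using f[of k] assms(2) unfolding K_def by linarith
  then have "patch_count (golden_layers a \<eta> \<delta>) T \<le> enat K"
    using agree by (rule patch_count_golden_layers_le[OF assms(1)])
  then have "ereal_of_enat (patch_count (golden_layers a \<eta> \<delta>) T) \<le> ereal_of_enat (enat K)"
    by (simp only: ereal_of_enat_le_iff)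
  also have "\<dots> \<le> ereal (2 * T + 1)"
    using assms(2) unfolding K_def by simp
  finally show ?thesis .
qed

text \<open>
  The index \<open>m\<close> is chosen with \<open>fib m \<le> 2 \<lfloor>T\<rfloor> < fib (m+1)\<close>; the worst case is near the left end, where
  the return time \<open>fib (m+2)\<close> is \<open>\<tau>\<^sup>2\<close> times as large as \<open>fib m\<close>, up to a bounded error.
\<close>
lemma repetitivity_golden_layers:
  fixes a :: "'n::finite"
  assumes \<tau>: "\<tau> = 1 / 2 * (1 + sqrt 5)" and "0 \<le> \<eta>" "0 < \<delta>" "0 < T"
  shows "repetitivity (golden_layers a \<eta> \<delta>) T
    \<le> ereal ((1 + \<eta>) * ((\<tau> + 1) * T + 1 / 2) + real CARD('n) * \<delta>)"
proof -
  obtain m where m: "fib m \<le> nat (2 * \<lfloor>T\<rfloor>)" "nat (2 * \<lfloor>T\<rfloor>) < fib (Suc m)"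
    by (rule fib_bracket)
  have "repetitivity (golden_layers a \<eta> \<delta>) T
      \<le> ereal ((1 + \<eta>) / 2 * real (fib (Suc (Suc m))) + real CARD('n) * \<delta>)"
    using assms m(2) by (intro repetitivity_golden_layers_le heights_agree_recurrent) auto
  also have "\<dots> \<le> ereal ((1 + \<eta>) * ((\<tau> + 1) * T + 1 / 2) + real CARD('n) * \<delta>)"
  proof -
    have "real (fib m) \<le> 2 * T"
      using m(1) assms(4) by linarith
    moreover have "0 \<le> \<tau> + 1" unfolding \<tau> by (simp add: field_simps add_nonneg_nonneg)
    ultimately have "(\<tau> + 1) * real (fib m) \<le> (\<tau> + 1) * (2 * T)"
      by (intro mult_left_mono)
    moreover have "2 * ((\<tau> + 1) * T + 1 / 2) = (\<tau> + 1) * (2 * T) + 1"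
      by (simp add: algebra_simps)
    ultimately have "real (fib (Suc (Suc m))) / 2 \<le> (\<tau> + 1) * T + 1 / 2"
      using fib_Suc_Suc_le_golden[OF \<tau>, of m] by linarith
    then have "(1 + \<eta>) * (real (fib (Suc (Suc m))) / 2) \<le> (1 + \<eta>) * ((\<tau> + 1) * T + 1 / 2)"
      using assms(2) by (intro mult_left_mono) auto
    then show ?thesis by simp
  qed
  finally show ?thesis .
qed

lemma small_spacing_change:
  assumes "0 < \<epsilon>"
  obtains \<eta> :: real where "0 < \<eta>" "\<eta> \<le> \<epsilon>" "\<eta> \<notin> \<rat>"
proof -
  obtain K :: nat where K: "1 < real K * \<epsilon>"
    using ex_less_of_nat_mult[OF assms] by blast
  then have "K > 0" by (intro Nat.gr0I) auto
  show ?thesis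
  proof
    show "0 < \<alpha> / real K" using inv_golden_bounds \<open>K > 0\<close> by simp
    show "\<alpha> / real K \<le> \<epsilon>" using inv_golden_bounds K \<open>K > 0\<close> by (simp add: field_simps)
    show "\<alpha> / real K \<notin> \<rat>"
    proof
      assume "\<alpha> / real K \<in> \<rat>"
      then have "real K * (\<alpha> / real K) \<in> \<rat>" by (intro Rats_mult Rats_of_nat)
      with \<open>K > 0\<close> inv_golden_irrational show False by simp
    qed
  qed
qed

theorem theorem6p2:
  fixes \<epsilon> \<tau> :: real
  assumes "\<epsilon> > 0"
    and "\<tau> = 1 / 2 * (1 + sqrt 5)"
  shows "\<exists>(X :: (real ^ 'n) set) R :: real.
    meyer_set X \<and> covering_radius X = ereal R \<and>
    \<not> ideal_crystal X \<and> linearly_repetitive X \<and>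
    (\<exists>T'>0. ereal_of_enat (patch_count X T') < ereal ((1 / 2 + \<epsilon>) * (T' / R)) \<and>
            repetitivity X T' < ereal ((1 / 2 + \<epsilon>) * T')) \<and>
    (\<exists>T\<^sub>0>0. \<forall>T>T\<^sub>0. ereal_of_enat (patch_count X T) < ereal ((1 + \<epsilon>) * (T / R)) \<and>
                    repetitivity X T < ereal ((\<tau> + 1 + \<epsilon>) * T))"
proof -
  \<comment> \<open>common budget for the tile length defect \<open>\<eta>\<close> and the mesh contribution \<open>n \<delta>\<close>\<close>
  define s where "s = min 1 \<epsilon> / 8"
  have s: "0 < s" "s \<le> 1 / 2" "8 * s \<le> \<epsilon>" using assms(1) by (auto simp: s_def)
  obtain \<eta> where \<eta>: "0 < \<eta>" "\<eta> \<le> s" "\<eta> \<notin> \<rat>"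
    using small_spacing_change s(1) by blast
  define \<delta> where "\<delta> = s / real CARD('n)"
  have \<delta>: "0 < \<delta>" "real CARD('n) * \<delta> = s" using s by (auto simp: \<delta>_def)
  define a :: 'n where "a = undefined"
  define X where "X = golden_layers a \<eta> \<delta>"
  obtain R where R: "covering_radius X = ereal R" "1 / 2 \<le> R" "R \<le> (1 + \<eta>) / 2 + s"
    using covering_radius_golden_layers[of \<eta> \<delta> a] \<eta>(1) \<delta> unfolding X_def by auto
  have R_le: "R \<le> 1 / 2 + 2 * s" using R(3) \<eta>(2) s(1) by (simp add: field_simps)
  have N1: "ereal_of_enat (patch_count X 1) < ereal ((1 / 2 + \<epsilon>) * (1 / R))"
  proof -
    have "patch_count X 1 \<le> enat 1"
      unfolding X_def using \<eta>(1) heights_agree_1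
      by (intro patch_count_golden_layers_le[where f = "\<lambda>_. 0"]) auto
    then have "ereal_of_enat (patch_count X 1) \<le> ereal_of_enat (enat 1)"
      by (simp only: ereal_of_enat_le_iff)
    also have "\<dots> < ereal ((1 / 2 + \<epsilon>) * (1 / R))"
      using R_le R(2) s by (simp add: field_simps)
    finally show ?thesis .
  qed
  have M1: "repetitivity X 1 < ereal ((1 / 2 + \<epsilon>) * 1)"
  proof -
    have "repetitivity X 1 \<le> ereal ((1 + \<eta>) / 2 * real 1 + real CARD('n) * \<delta>)"
      unfolding X_def using \<eta>(1) \<delta>(1) heights_agree_1
      by (intro repetitivity_golden_layers_le) (auto intro: exI[of _ l0 for l0])
    also have "\<dots> < ereal ((1 / 2 + \<epsilon>) * 1)"
      using \<eta>(2) \<delta> s by (simp add: field_simps)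
    finally show ?thesis .
  qed
  \<comment> \<open>beyond this radius the bounded summands in both linear bounds are below \<open>s T\<close>\<close>
  define T\<^sub>0 where "T\<^sub>0 = 1 / s"
  have "T\<^sub>0 > 0" using s by (simp add: T\<^sub>0_def)
  have large: "ereal_of_enat (patch_count X T) < ereal ((1 + \<epsilon>) * (T / R)) \<and>
               repetitivity X T < ereal ((\<tau> + 1 + \<epsilon>) * T)" if "T > T\<^sub>0" for T
  proof
    have T: "1 < s * T" using that s by (simp add: T\<^sub>0_def field_simps)
    have "0 < T" using that \<open>T\<^sub>0 > 0\<close> by simp
    have sT: "0 < s * T" "8 * (s * T) \<le> \<epsilon> * T" "s * (s * T) \<le> 1 / 2 * (s * T)"
      using s \<open>0 < T\<close> by (auto intro: mult_right_mono)
    have "(2 * T + 1) * R \<le> (2 * T + 1) * (1 / 2 + 2 * s)"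
      using R_le \<open>0 < T\<close> by (intro mult_left_mono) auto
    also have "\<dots> < (1 + \<epsilon>) * T"
      using T sT s by (simp add: algebra_simps)
    finally have "2 * T + 1 < (1 + \<epsilon>) * (T / R)"
      using R(2) by (simp add: field_simps)
    then have "ereal (2 * T + 1) < ereal ((1 + \<epsilon>) * (T / R))"
      by (simp only: less_ereal.simps)
    with patch_count_golden_layers[OF order.strict_implies_order[OF \<eta>(1)] \<open>0 < T\<close>]
    show "ereal_of_enat (patch_count X T) < ereal ((1 + \<epsilon>) * (T / R))"
      unfolding X_def by (rule le_less_trans)
    have "sqrt 5 < sqrt 9" by (intro real_sqrt_less_mono) simp
    then have "\<tau> + 1 \<le> 3" using assms(2) by simp
    moreover have "0 \<le> \<tau> + 1"
      unfolding assms(2) by (simp add: field_simps add_nonneg_nonneg)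
    ultimately have "0 \<le> (\<tau> + 1) * T" "(\<tau> + 1) * T \<le> 3 * T"
      using \<open>0 < T\<close> by (auto intro: mult_right_mono)
    then have "\<eta> * ((\<tau> + 1) * T + 1 / 2) \<le> s * (3 * T + 1 / 2)"
      using \<eta>(1,2) s(1) by (intro mult_mono) auto
    moreover have "(1 + \<eta>) * ((\<tau> + 1) * T + 1 / 2) + real CARD('n) * \<delta>
        = (\<tau> + 1) * T + 1 / 2 + \<eta> * ((\<tau> + 1) * T + 1 / 2) + s"
      unfolding \<delta>(2) distrib_right[of 1 \<eta>] by simp
    moreover have "s * (3 * T + 1 / 2) = 3 * (s * T) + s / 2"
      by (simp add: algebra_simps)
    moreover have "(\<tau> + 1 + \<epsilon>) * T = (\<tau> + 1) * T + \<epsilon> * T"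
      by (rule distrib_right)
    ultimately have "(1 + \<eta>) * ((\<tau> + 1) * T + 1 / 2) + real CARD('n) * \<delta> < (\<tau> + 1 + \<epsilon>) * T"
      using sT T s by linarith
    then have "ereal ((1 + \<eta>) * ((\<tau> + 1) * T + 1 / 2) + real CARD('n) * \<delta>)
        < ereal ((\<tau> + 1 + \<epsilon>) * T)"
      by (simp only: less_ereal.simps)
    with repetitivity_golden_layers[OF assms(2) order.strict_implies_order[OF \<eta>(1)] \<delta>(1) \<open>0 < T\<close>]
    show "repetitivity X T < ereal ((\<tau> + 1 + \<epsilon>) * T)"
      unfolding X_def by (rule le_less_trans)
  qed
  have "linearly_repetitive X"
    unfolding linearly_repetitive_def
    by (rule exI[of _ "\<tau> + 1 + \<epsilon>"], rule exI[of _ "T\<^sub>0 + 1"]) (use large \<open>T\<^sub>0 > 0\<close> in auto)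
  moreover have "meyer_set X" "\<not> ideal_crystal X"
    using meyer_set_golden_layers[of \<eta> \<delta> a] not_ideal_crystal_golden_layers[of \<eta> a \<delta>] \<eta> \<delta> s
    unfolding X_def by auto
  moreover have "\<exists>T'>0. ereal_of_enat (patch_count X T') < ereal ((1 / 2 + \<epsilon>) * (T' / R)) \<and>
      repetitivity X T' < ereal ((1 / 2 + \<epsilon>) * T')"
    using N1 M1 by (intro exI[of _ 1] conjI zero_less_one)
  ultimately show ?thesis
    using R(1) \<open>T\<^sub>0 > 0\<close> large by blast
qed

end
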